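(* There is an absolute constant $C>0$ such that the following holds for all real $\tilde\delta\in(0,1]$, $\varepsilon>0$ and $0<\beta\le 1$. There exist positive integers $n_o$, $N$, $n_l$ with $$n_o\le C\,\Bigl(1+\log^+\tfrac{\beta}{\varepsilon}\Bigr),\qquad N\le C\,\Bigl(1+\log\bigl(1+\log^+\tfrac{\beta}{\varepsilon}\bigr)+\log\tfrac{1}{\tilde\delta}\Bigr),$$ $$n_l\le C\,\Bigl(1+\log^+\tfrac{\beta}{\varepsilon}+\log\bigl(1+\log\tfrac{1}{\tilde\delta}\bigr)\Bigr)$$ (that is, $n_o=O(\log\frac{\beta}{\varepsilon})$, $N=O(\log\log\frac{\beta}{\varepsilon}+\log\frac1{\tilde\delta})$ and $n_l=O(\log\frac{\beta}{\varepsilon}+\log\log\frac1{\tilde\delta})$) such that, if $s_{o,1},\dots,s_{o,n_o}$ and $w_{o,1},\dots,w_{o,n_o}$ are the nodes and weights of the $n_o$-point Gauss-Jacobi quadrature on $[0,1]$ with weight function $s^{\beta-1}$, and, for each $j=0,\dots,N-1$, $s_{j,1},\dots,s_{j,n_l}$ and $w_{j,1},\dots,w_{j,n_l}$ are the nodes and weights of the $n_l$-point Gauss-Legendre quadrature on $[2^j,2^{j+1}]$, then for every $t\in[\tilde\delta,1]$, $$\left|\frac{1}{t^\beta}-\frac{\beta}{\Gamma(1+\beta)}\left(\sum_{k=1}^{n_o}e^{-s_{o,k}t}w_{o,k}+\sum_{j=0}^{N-1}\sum_{k=1}^{n_l}e^{-s_{j,k}t}s_{j,k}^{\beta-1}w_{j,k}\right)\right|\le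 \varepsilon\,\frac{1}{t^\beta}.$$
   Context: $\log^+x=\max(0,\log x)$ for $x>0$, and $\Gamma$ is the Gamma function. The $n$-point Gauss-Jacobi quadrature on $[0,1]$ with weight $s^{\beta-1}$ is the unique $n$-point rule with nodes $s_k\in(0,1)$ and weights $w_k>0$ such that $\int_0^1 p(s)s^{\beta-1}\,ds=\sum_{k=1}^n w_k p(s_k)$ for all polynomials $p$ of degree at most $2n-1$. The $n$-point Gauss-Legendre quadrature on $[a,b]$ is the unique $n$-point rule with nodes $s_k\in(a,b)$ and weights $w_k>0$ such that $\int_a^b p(s)\,ds=\sum_{k=1}^n w_kp(s_k)$ for all polynomials $p$ of degree at most $2n-1$. *)

theory Defs
  imports "HOL-Analysis.Analysis" "HOL-Computational_Algebra.Polynomial"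
begin

definition ln_plus :: "real \<Rightarrow> real"
  where "ln_plus x = max 0 (ln x)"

(* "s 1, ..., s n and w 1, ..., w n are the nodes and weights of the n-point Gauss rule on [a, b]
   for the weight function \<omega>", for n \<ge> 1.  The rule is unique up to the order of the nodes, so it
   is rendered as a predicate on indexed nodes and weights (any enumeration is allowed).
   Since has_integral includes integrability, the defining identity is not satisfied by a
   default value of the integral. *)
definition gauss_quadrature ::
    "real \<Rightarrow> real \<Rightarrow> (real \<Rightarrow> real) \<Rightarrow> nat \<Rightarrow> (nat \<Rightarrow> real) \<Rightarrow> (nat \<Rightarrow> real) \<Rightarrow> bool"
  where "gauss_quadrature a b \<omega> n s w \<longleftrightarrow>
    inj_on s {1..n} \<and>
    (\<forall>k\<in>{1..n}. s k \<in> {a<..<b} \<and> w k > 0) \<and>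
    (\<forall>p :: real poly. degree p \<le> 2 * n - 1 \<longrightarrow>
      ((\<lambda>x. poly p x * \<omega> x) has_integral (\<Sum>k=1..n. w k * poly p (s k))) {a..b})"

(* The weight x powr (\<beta> - 1) takes the value 0 at x = 0, which does not affect the integral. *)
definition gauss_jacobi :: "real \<Rightarrow> nat \<Rightarrow> (nat \<Rightarrow> real) \<Rightarrow> (nat \<Rightarrow> real) \<Rightarrow> bool"
  where "gauss_jacobi \<beta> n s w \<longleftrightarrow> gauss_quadrature 0 1 (\<lambda>x. x powr (\<beta> - 1)) n s w"

definition gauss_legendre ::
    "real \<Rightarrow> real \<Rightarrow> nat \<Rightarrow> (nat \<Rightarrow> real) \<Rightarrow> (nat \<Rightarrow> real) \<Rightarrow> bool"
  where "gauss_legendre a b n s w \<longleftrightarrow> gauss_quadrature a b (\<lambda>x. 1) n s w"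

end

theory Submission
  imports Defs
begin

text \<open>
  Since \<open>\<beta> / Gamma (1 + \<beta>) = 1 / Gamma \<beta>\<close>, the sum in the theorem discretises the Laplace representation
  \<open>1 / t powr \<beta> = 1 / Gamma \<beta> * integral {0..} (\<lambda>x. exp (- x * t) * x powr (\<beta> - 1))\<close>.
  The half-line is cut into \<open>{0..1}\<close>, the dyadic intervals \<open>{2 ^ j..2 ^ (j + 1)}\<close> with \<open>j < N\<close>, and the
  tail \<open>{2 ^ N..}\<close>. The prefactor is at most a constant times \<open>\<beta>\<close>, because \<open>Gamma\<close> is bounded below on
  \<open>{1..2}\<close>, so the error on the integral may be a constant times \<open>\<epsilon> / \<beta> * (1 / t powr \<beta>)\<close>; it is
  shared equally by the three parts.

  On each bounded piece the quadrature error is controlled by a polynomial that approximates the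
  integrand, and a single principle serves both kinds of pieces (\<open>gauss_quadrature_error\<close>): if the
  pointwise error of the approximation is dominated by a polynomial \<open>q\<close> that the rule integrates
  exactly, the quadrature error is at most twice the integral of \<open>q\<close> against the weight.

  On \<open>{0..1}\<close> the approximation is the Taylor polynomial at \<open>0\<close> and \<open>q\<close> is a multiple of
  \<open>x ^ (2 * n - 1)\<close>. As \<open>q\<close> vanishes at \<open>0\<close>, its integral against \<open>x powr (\<beta> - 1)\<close> does not see the
  total mass \<open>1 / \<beta>\<close> of the weight (\<open>gauss_jacobi_exp_error\<close>). This is what makes \<open>n\<^sub>o\<close> depend on
  \<open>\<beta> / \<epsilon>\<close> rather than on \<open>1 / \<epsilon>\<close>.

  On a dyadic interval \<open>{a..2 * a}\<close> the integrand, written in the variable \<open>v = 3 / 2 * a - x\<close>, is a power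
  series with nonnegative coefficients that converges for \<open>\<bar>v\<bar> < 3 / 2 * a\<close>. The interval is
  \<open>\<bar>v\<bar> \<le> a / 2\<close>, so comparison with the value at \<open>v = a\<close> bounds the remainder after \<open>2 * n\<close> terms
  by \<open>1 / 4 ^ n\<close> times that value. The factor \<open>exp (- a * t / 2)\<close> in it makes the error at most a
  constant times \<open>1 / 4 ^ n * (1 / t powr \<beta>)\<close>, uniformly in \<open>a\<close>
  (\<open>gauss_legendre_dyadic_error\<close>); hence \<open>n\<^sub>l\<close> has to beat only the number \<open>N\<close> of intervals and
  \<open>\<beta> / \<epsilon>\<close>.

  Once \<open>2 ^ N * t\<close> is at least \<open>1\<close>, the tail is at most
  \<open>exp (- (2 ^ N * t)) * (1 / t powr \<beta>)\<close>, so it suffices that \<open>2 ^ N * \<delta>\<close>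
  exceeds a constant plus \<open>ln_plus (\<beta> / \<epsilon>)\<close>. Solving for \<open>N\<close> takes the logarithm of this quantity,
  which is why \<open>\<epsilon>\<close> enters the bound on \<open>N\<close> only doubly logarithmically.
\<close>

section \<open>Quadrature error from polynomial approximation\<close>

text \<open>
  With the exact rule for \<open>p\<close>, the error splits into the integral of \<open>f - p\<close> and the quadrature sum of
  \<open>p - f\<close>. Positivity of the weights bounds the second by the quadrature sum of \<open>q\<close>, which equals the
  integral \<open>J\<close> because the rule is exact for \<open>q\<close> too. Allowing a non-constant \<open>q\<close> matters for a
  weight whose mass is concentrated at a point where \<open>q\<close> is small.
\<close>

lemma gauss_quadrature_error:
  fixes f \<omega> :: "real \<Rightarrow> real" and p q :: "real poly"
  assumes Q: "gauss_quadrature a b \<omega> n s w"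
    and f: "((\<lambda>x. f x * \<omega> x) has_integral I) {a..b}"
    and deg: "degree p \<le> 2 * n - 1" "degree q \<le> 2 * n - 1"
    and pos: "\<And>x. x \<in> {a..b} \<Longrightarrow> 0 \<le> \<omega> x"
    and approx: "\<And>x. x \<in> {a..b} \<Longrightarrow> \<bar>f x - poly p x\<bar> \<le> poly q x"
    and q: "((\<lambda>x. poly q x * \<omega> x) has_integral J) {a..b}"
  shows "\<bar>I - (\<Sum>k=1..n. w k * f (s k))\<bar> \<le> 2 * J"
proof -
  have node: "s k \<in> {a..b}" "0 < w k" if "k \<in> {1..n}" for k
    using Q that unfolding gauss_quadrature_def by force+
  have ex: "((\<lambda>x. poly r x * \<omega> x) has_integral (\<Sum>k=1..n. w k * poly r (s k))) {a..b}"
    if "degree r \<le> 2 * n - 1" for r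
    using Q that unfolding gauss_quadrature_def by blast
  have "J = (\<Sum>k=1..n. w k * poly q (s k))"
    using q ex[OF deg(2)] has_integral_unique by blast
  moreover have "\<bar>(\<Sum>k=1..n. w k * poly p (s k)) - (\<Sum>k=1..n. w k * f (s k))\<bar>
      \<le> (\<Sum>k=1..n. w k * poly q (s k))"
    unfolding sum_subtractf[symmetric] right_diff_distrib[symmetric]
  proof (rule order_trans[OF sum_abs sum_mono])
    fix k assume k: "k \<in> {1..n}"
    then show "\<bar>w k * (poly p (s k) - f (s k))\<bar> \<le> w k * poly q (s k)"
      using approx[OF node(1)[OF k]] node(2)[OF k]
      by (simp add: abs_mult abs_minus_commute)
  qed
  moreover have "\<bar>I - (\<Sum>k=1..n. w k * poly p (s k))\<bar> \<le> J"
  proof -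
    have d: "((\<lambda>x. f x * \<omega> x - poly p x * \<omega> x) has_integral
        (I - (\<Sum>k=1..n. w k * poly p (s k)))) {a..b}"
      by (intro has_integral_diff f ex deg)
    have "norm (f x * \<omega> x - poly p x * \<omega> x) \<le> poly q x * \<omega> x" if "x \<in> {a..b}" for x
      using approx[OF that] pos[OF that]
      by (simp add: left_diff_distrib[symmetric] abs_mult mult_right_mono)
    then have "norm (integral {a..b} (\<lambda>x. f x * \<omega> x - poly p x * \<omega> x))
        \<le> integral {a..b} (\<lambda>x. poly q x * \<omega> x)"
      using d q by (intro integral_norm_bound_integral) (auto simp: integrable_on_def)
    then show ?thesis
      using integral_unique[OF d] integral_unique[OF q] by simp
  qed
  ultimately show ?thesis by linarith
qed

section \<open>The Gauss-Jacobi rule on the unit interval\<close>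

lemma exp_minus_Taylor:
  fixes x :: real
  assumes "0 \<le> x" "0 < m"
  shows "\<bar>exp (- x) - (\<Sum>k<m. (- x) ^ k / fact k)\<bar> \<le> x ^ m / fact m"
proof (cases "x = 0")
  case True
  have "(\<Sum>k<m. (- x) ^ k / fact k) = (\<Sum>k<m. if k = 0 then 1 else 0)"
    using True by (intro sum.cong) auto
  then show ?thesis using True assms by simp
next
  case False
  then obtain u where u: "u < 0"
    "exp (- x) = (\<Sum>k<m. exp 0 / fact k * (- x) ^ k) + exp u / fact m * (- x) ^ m"
    using Maclaurin_minus[of "- x" m "\<lambda>_. exp" exp] assms by (auto intro: DERIV_exp)
  then have "\<bar>exp (- x) - (\<Sum>k<m. (- x) ^ k / fact k)\<bar> = exp u * (x ^ m / fact m)"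
    using assms by (simp add: abs_mult power_abs)
  also have "\<dots> \<le> 1 * (x ^ m / fact m)"
    using u assms by (intro mult_right_mono) auto
  finally show ?thesis by simp
qed

lemma four_power_le_fact:
  assumes "0 < n"
  shows "4 ^ n / 4 \<le> (fact (2 * n - 1) :: real)"
  using assms
proof (induction n rule: nat_induct_non_zero)
  case (Suc n)
  have "fact (2 * Suc n - 1) = (fact (Suc (Suc (2 * n - 1))) :: real)"
    using Suc.hyps by (intro arg_cong[where f=fact]) simp
  also have "\<dots> = real (2 * n + 1) * real (2 * n) * fact (2 * n - 1)"
  proof -
    from Suc.hyps obtain k where "n = Suc k" using gr0_implies_Suc by blast
    then show ?thesis by (simp add: algebra_simps)
  qed
  also have "\<dots> \<ge> 2 * 2 * (4 ^ n / 4)"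
    using Suc by (intro mult_mono) auto
  finally show ?case by simp
qed auto

text \<open>
  The bound is uniform in \<open>\<beta>\<close>, although the weight has total mass \<open>1 / \<beta>\<close>. The Taylor polynomial has
  degree \<open>2 * n - 2\<close> only, one less than possible, so that the monomial of the remainder is still
  integrated exactly.
\<close>

lemma gauss_jacobi_exp_error:
  assumes Q: "gauss_jacobi \<beta> n s w" and n: "0 < n" and \<beta>: "0 < \<beta>" and t: "0 \<le> t" "t \<le> 1"
    and I: "((\<lambda>x. exp (- x * t) * x powr (\<beta> - 1)) has_integral I) {0..1}"
  shows "\<bar>I - (\<Sum>k=1..n. w k * exp (- s k * t))\<bar> \<le> 8 / 4 ^ n"
proof -
  define m where "m = 2 * n - 1"
  have m: "0 < m" using n by (simp add: m_def)
  define p where "p = (\<Sum>k<m. monom ((- t) ^ k / fact k) k)"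
  define q where "q = monom (1 / fact m :: real) m"
  have "((\<lambda>x. x powr (real m + \<beta> - 1)) has_integral 1 / (real m + \<beta>)) {0..1}"
    using has_integral_powr_from_0[of "real m + \<beta> - 1" 1] m \<beta> by simp
  then have q_int: "((\<lambda>x. 1 / fact m * x powr (real m + \<beta> - 1)) has_integral
      1 / fact m * (1 / (real m + \<beta>))) {0..1}"
    by (rule has_integral_mult_right)
  have q_eq: "1 / fact m * x powr (real m + \<beta> - 1) = poly q x * x powr (\<beta> - 1)"
    if "x \<in> {0..1}" for x
  proof (cases "x = 0")
    case False
    then have "x powr (real m + \<beta> - 1) = x ^ m * x powr (\<beta> - 1)"
      using that by (simp add: powr_realpow[symmetric] powr_add[symmetric] algebra_simps)
    then show ?thesis by (simp add: q_def poly_monom)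
  qed simp
  have J: "((\<lambda>x. poly q x * x powr (\<beta> - 1)) has_integral
      1 / fact m * (1 / (real m + \<beta>))) {0..1}"
    by (rule has_integral_eq[OF q_eq q_int])
  have "\<bar>I - (\<Sum>k=1..n. w k * exp (- s k * t))\<bar> \<le> 2 * (1 / fact m * (1 / (real m + \<beta>)))"
  proof (rule gauss_quadrature_error[OF Q[unfolded gauss_jacobi_def] I _ _ _ _ J])
    show "degree p \<le> 2 * n - 1"
      unfolding p_def m_def[symmetric]
      by (intro degree_sum_le) (auto intro: order_trans[OF degree_monom_le])
    show "degree q \<le> 2 * n - 1"
      unfolding q_def m_def[symmetric] by (rule degree_monom_le)
    show "\<bar>exp (- x * t) - poly p x\<bar> \<le> poly q x" if x: "x \<in> {0..1}" for x
    proof -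
      have "poly p x = (\<Sum>k<m. (- (x * t)) ^ k / fact k)"
        unfolding p_def poly_sum poly_monom
      proof (rule sum.cong[OF refl])
        fix k
        have "(- t) ^ k * x ^ k = (- (x * t)) ^ k"
          by (simp add: power_mult_distrib[symmetric] mult.commute)
        then show "(- t) ^ k / fact k * x ^ k = (- (x * t)) ^ k / fact k" by simp
      qed
      then have "\<bar>exp (- x * t) - poly p x\<bar> \<le> (x * t) ^ m / fact m"
        using exp_minus_Taylor[of "x * t" m] x t m by simp
      also have "\<dots> \<le> x ^ m / fact m"
        using x t by (intro divide_right_mono power_mono) (auto simp: mult_left_le)
      finally show ?thesis by (simp add: q_def poly_monom)
    qed
  qed simp
  also have "\<dots> \<le> 2 * (1 / fact m * 1)"
    using m \<beta> by (intro mult_left_mono) auto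
  also have "\<dots> \<le> 2 * (1 / (4 ^ n / 4))"
    using four_power_le_fact[OF n] by (simp only: m_def mult_1_right, intro mult_left_mono divide_left_mono) auto
  finally show ?thesis by simp
qed

section \<open>The Gauss-Legendre rule on a dyadic interval\<close>

text \<open>
  Nonnegative coefficients replace Cauchy estimates: the single value \<open>H\<close> at \<open>R\<close> controls every
  remainder inside the disc of radius \<open>\<rho> * R\<close>.
\<close>

lemma nonneg_power_series_tail:
  fixes \<alpha> :: "nat \<Rightarrow> real"
  assumes nonneg: "\<And>k. 0 \<le> \<alpha> k"
    and v: "(\<lambda>k. \<alpha> k * v ^ k) sums G" and R: "(\<lambda>k. \<alpha> k * R ^ k) sums H"
    and bd: "\<bar>v\<bar> \<le> \<rho> * R" "0 \<le> \<rho>" "\<rho> \<le> 1" "0 \<le> R"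
  shows "\<bar>G - (\<Sum>k<m. \<alpha> k * v ^ k)\<bar> \<le> \<rho> ^ m * H"
proof -
  have tail: "(\<lambda>k. \<alpha> (k + m) * v ^ (k + m)) sums (G - (\<Sum>k<m. \<alpha> k * v ^ k))"
    using v sums_iff_shift[of "\<lambda>k. \<alpha> k * v ^ k" m] by auto
  have tailR: "(\<lambda>k. \<rho> ^ m * (\<alpha> (k + m) * R ^ (k + m))) sums (\<rho> ^ m * (H - (\<Sum>k<m. \<alpha> k * R ^ k)))"
    using R sums_iff_shift[of "\<lambda>k. \<alpha> k * R ^ k" m] by (intro sums_mult) auto
  have "norm (\<Sum>k. \<alpha> (k + m) * v ^ (k + m)) \<le> (\<Sum>k. \<rho> ^ m * (\<alpha> (k + m) * R ^ (k + m)))"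
  proof (rule norm_suminf_le[OF _ sums_summable[OF tailR]])
    fix k
    have "\<bar>v\<bar> ^ (k + m) \<le> (\<rho> * R) ^ (k + m)"
      using bd by (intro power_mono) auto
    also have "\<dots> \<le> \<rho> ^ m * R ^ (k + m)"
      using bd by (simp add: power_mult_distrib power_decreasing mult_right_mono)
    finally show "norm (\<alpha> (k + m) * v ^ (k + m)) \<le> \<rho> ^ m * (\<alpha> (k + m) * R ^ (k + m))"
      using mult_left_mono[of _ "\<rho> ^ m * R ^ (k + m)", OF _ nonneg[of "k + m"]] nonneg[of "k + m"]
      by (simp add: abs_mult power_abs mult.left_commute)
  qed
  also have "\<dots> = \<rho> ^ m * (H - (\<Sum>k<m. \<alpha> k * R ^ k))"
    using tailR sums_unique by metis
  also have "\<dots> \<le> \<rho> ^ m * H"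
    using bd nonneg by (intro mult_left_mono) (auto intro!: sum_nonneg)
  finally show ?thesis using sums_unique[OF tail] by simp
qed

text \<open>
  Expanding leftwards from \<open>c\<close> makes both factors absolutely monotone: \<open>exp (v * t)\<close> has the
  coefficients \<open>t ^ k / fact k\<close>, and the binomial series of the nonpositive power \<open>\<beta> - 1\<close> of \<open>c - v\<close>
  has coefficients proportional to \<open>pochhammer (1 - \<beta>) k\<close>. The Cauchy product keeps the sign.
\<close>

lemma exp_powr_nonneg_power_series:
  fixes c t \<beta> :: real
  assumes "0 \<le> t" "\<beta> \<le> 1"
  obtains \<alpha> :: "nat \<Rightarrow> real" where "\<And>k. 0 \<le> \<alpha> k"
    "\<And>v. \<bar>v\<bar> < c \<Longrightarrow> (\<lambda>k. \<alpha> k * v ^ k) sums (exp (- (c - v) * t) * (c - v) powr (\<beta> - 1))"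
proof -
  define e where "e k = exp (- c * t) * (t ^ k / fact k)" for k
  define b where "b k = pochhammer (1 - \<beta>) k / fact k * c powr (\<beta> - 1 - real k)" for k
  have "0 \<le> pochhammer (1 - \<beta>) k" for k
    using assms by (induction k) (auto simp: pochhammer_Suc)
  then have b0: "0 \<le> b k" for k by (simp add: b_def)
  have e0: "0 \<le> e k" for k using assms by (simp add: e_def)
  have es: "(\<lambda>k. e k * v ^ k) sums exp (- (c - v) * t)" for v
  proof -
    have "(\<lambda>k. exp (- c * t) * ((v * t) ^ k /\<^sub>R fact k)) sums (exp (- c * t) * exp (v * t))"
      by (intro sums_mult exp_converges)
    then show ?thesis
      by (simp add: e_def exp_add[symmetric] power_mult_distrib divide_inverse algebra_simps)
  qed
  have bs: "(\<lambda>k. b k * v ^ k) sums (c - v) powr (\<beta> - 1)" if "\<bar>v\<bar> < c" for v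
  proof -
    have *: "(\<lambda>k. ((\<beta> - 1) gchoose k) * (- v) ^ k * c powr (\<beta> - 1 - real k))
        sums (- v + c) powr (\<beta> - 1)"
      using that by (intro gen_binomial_real') simp
    have "((\<beta> - 1) gchoose k) * (- v) ^ k * c powr (\<beta> - 1 - real k) = b k * v ^ k" for k
    proof -
      have "(-1) ^ k * (-1) ^ k = (1 :: real)" by (simp add: power_add[symmetric])
      moreover have "((\<beta> - 1) gchoose k) * (- v) ^ k = ((-1) ^ k * (-1) ^ k) * (pochhammer (1 - \<beta>) k / fact k * v ^ k)"
        unfolding gbinomial_pochhammer power_minus[of v] by simp
      ultimately show ?thesis by (simp add: b_def)
    qed
    then show ?thesis using * by simp
  qed
  show thesis
  proof
    show "0 \<le> (\<Sum>i\<le>k. e i * b (k - i))" for k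
      by (intro sum_nonneg mult_nonneg_nonneg e0 b0)
    show "(\<lambda>k. (\<Sum>i\<le>k. e i * b (k - i)) * v ^ k) sums
        (exp (- (c - v) * t) * (c - v) powr (\<beta> - 1))" if v: "\<bar>v\<bar> < c" for v
    proof -
      have "(\<lambda>k. \<Sum>i\<le>k. (e i * v ^ i) * (b (k - i) * v ^ (k - i))) sums
          ((\<Sum>k. e k * v ^ k) * (\<Sum>k. b k * v ^ k))"
      proof (rule Cauchy_product_sums)
        show "summable (\<lambda>k. norm (e k * v ^ k))"
          using sums_summable[OF es[of "\<bar>v\<bar>"]] e0 by (simp add: abs_mult power_abs abs_of_nonneg)
        show "summable (\<lambda>k. norm (b k * v ^ k))"
          using sums_summable[OF bs[of "\<bar>v\<bar>"]] b0 v by (simp add: abs_mult power_abs)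
      qed
      moreover have "(\<Sum>i\<le>k. (e i * v ^ i) * (b (k - i) * v ^ (k - i)))
          = (\<Sum>i\<le>k. e i * b (k - i)) * v ^ k" for k
        unfolding sum_distrib_right
      proof (rule sum.cong)
        fix i assume "i \<in> {..k}"
        then have "v ^ k = v ^ i * v ^ (k - i)" by (simp add: power_add[symmetric])
        then show "(e i * v ^ i) * (b (k - i) * v ^ (k - i)) = e i * b (k - i) * v ^ k"
          by (simp add: mult_ac)
      qed simp
      ultimately show ?thesis
        using sums_unique[OF es[of v]] sums_unique[OF bs[OF v]] by simp
    qed
  qed
qed

text \<open>
  The comparison value \<open>H\<close> is that of the integrand at \<open>a / 2\<close>, the point \<open>v = a\<close>. It keeps the
  decay \<open>exp (- (a / 2) * t)\<close>, which absorbs the factor \<open>(a * t) powr \<beta>\<close> that appears when the bound is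
  measured in units of \<open>1 / t powr \<beta>\<close>.
\<close>

lemma gauss_legendre_dyadic_error:
  assumes Q: "gauss_legendre a (2 * a) n s w" and a: "0 < a"
    and \<beta>: "0 < \<beta>" "\<beta> \<le> 1" and t: "0 < t"
    and I: "((\<lambda>x. exp (- x * t) * x powr (\<beta> - 1)) has_integral I) {a..2 * a}"
  shows "\<bar>I - (\<Sum>k=1..n. w k * (exp (- s k * t) * s k powr (\<beta> - 1)))\<bar> \<le> 4 / 4 ^ n * (1 / t powr \<beta>)"
proof -
  define c where "c = 3 / 2 * a"
  obtain \<alpha> where \<alpha>: "\<And>k. 0 \<le> \<alpha> k"
    "\<And>v. \<bar>v\<bar> < c \<Longrightarrow> (\<lambda>k. \<alpha> k * v ^ k) sums (exp (- (c - v) * t) * (c - v) powr (\<beta> - 1))"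
    using that by (rule exp_powr_nonneg_power_series[OF less_imp_le[OF t] \<beta>(2), where c = c])
  define H where "H = exp (- (a / 2) * t) * (a / 2) powr (\<beta> - 1)"
  have R: "(\<lambda>k. \<alpha> k * a ^ k) sums H"
    using \<alpha>(2)[of a] a by (simp add: c_def H_def)
  define p where "p = (\<Sum>k<2 * n. smult (\<alpha> k) ([:c, -1:] ^ k))"
  define q where "q = [:H / 4 ^ n:]"
  have J: "((\<lambda>x. poly q x * 1) has_integral a * (H / 4 ^ n)) {a..2 * a}"
    using has_integral_const_real[of "H / 4 ^ n" a "2 * a"] a by (simp add: q_def)
  have "\<bar>I - (\<Sum>k=1..n. w k * (exp (- s k * t) * s k powr (\<beta> - 1)))\<bar> \<le> 2 * (a * (H / 4 ^ n))"
  proof (rule gauss_quadrature_error[OF Q[unfolded gauss_legendre_def] _ _ _ _ _ J])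
    show "((\<lambda>x. exp (- x * t) * x powr (\<beta> - 1) * 1) has_integral I) {a..2 * a}"
      using I by simp
    show "degree p \<le> 2 * n - 1"
      unfolding p_def
    proof (rule degree_sum_le)
      fix k assume k: "k \<in> {..<2 * n}"
      have "degree (smult (\<alpha> k) ([:c, -1:] ^ k)) \<le> degree ([:c, -1:] ^ k)"
        by (rule degree_smult_le)
      also have "\<dots> \<le> degree [:c, -1:] * k" by (rule degree_power_le)
      also have "\<dots> \<le> 2 * n - 1" using k by auto
      finally show "degree (smult (\<alpha> k) ([:c, -1:] ^ k)) \<le> 2 * n - 1" .
    qed simp
    show "degree q \<le> 2 * n - 1" by (simp add: q_def)
    show "\<bar>exp (- x * t) * x powr (\<beta> - 1) - poly p x\<bar> \<le> poly q x" if x: "x \<in> {a..2 * a}" for x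
    proof -
      have v: "\<bar>c - x\<bar> \<le> 1 / 2 * a" using x by (auto simp: c_def abs_if)
      then have "(\<lambda>k. \<alpha> k * (c - x) ^ k) sums (exp (- x * t) * x powr (\<beta> - 1))"
        using \<alpha>(2)[of "c - x"] a by (simp add: c_def)
      then have "\<bar>exp (- x * t) * x powr (\<beta> - 1) - (\<Sum>k<2 * n. \<alpha> k * (c - x) ^ k)\<bar>
          \<le> (1 / 2) ^ (2 * n) * H"
        using nonneg_power_series_tail[OF \<alpha>(1) _ R v] a by simp
      then show ?thesis
        by (simp add: p_def q_def poly_sum power_mult power2_eq_square power_one_over)
    qed
  qed simp
  also have "\<dots> \<le> 4 / 4 ^ n * (1 / t powr \<beta>)"
  proof -
    have "a * H \<le> 2 * (1 / t powr \<beta>)"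
    proof -
      define y where "y = a / 2 * t"
      have y: "0 < y" using a t by (simp add: y_def)
      have "y powr \<beta> \<le> 1 + y"
      proof -
        have "y powr \<beta> \<le> (1 + y) powr \<beta>" using y \<beta> by (intro powr_mono2) auto
        also have "\<dots> \<le> (1 + y) powr 1" using y \<beta> by (intro powr_mono) auto
        finally show ?thesis using y by simp
      qed
      also have "\<dots> \<le> exp y" by simp
      finally have yb: "exp (- y) * y powr \<beta> \<le> 1"
        by (simp add: exp_minus divide_simps)
      have "(a / 2) * (a / 2) powr (\<beta> - 1) = (a / 2) powr \<beta>"
        using a powr_mult_base[of "a / 2" "\<beta> - 1"] by simp
      then have "a * H = 2 * exp (- y) * (a / 2) powr \<beta>"
        unfolding H_def y_def by (simp add: field_simps)
      also have "(a / 2) powr \<beta> = y powr \<beta> * (1 / t powr \<beta>)"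
        unfolding y_def powr_mult using t by simp
      also have "2 * exp (- y) * (y powr \<beta> * (1 / t powr \<beta>)) = 2 * (exp (- y) * y powr \<beta>) * (1 / t powr \<beta>)"
        by simp
      also have "\<dots> \<le> 2 * (1 / t powr \<beta>)"
        using yb by (intro mult_right_mono) auto
      finally show ?thesis .
    qed
    then show ?thesis by (simp add: field_simps)
  qed
  finally show ?thesis .
qed

section \<open>The Laplace representation and its truncation\<close>

lemma has_integral_laplace_powr:
  fixes \<beta> t :: real
  assumes \<beta>: "0 < \<beta>" and t: "0 < t"
  shows "((\<lambda>x. exp (- x * t) * x powr (\<beta> - 1)) has_integral Gamma \<beta> / t powr \<beta>) {0..}"
proof -
  let ?f = "\<lambda>x. x powr (\<beta> - 1) / exp x"
  have G: "(?f has_integral Gamma \<beta>) {0..}" using \<beta> by (rule Gamma_integral_real)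
  have img: "(*) t ` {0..} = {0..}"
  proof -
    have "x \<in> (*) t ` {0..}" if "0 \<le> x" for x
      using that t by (intro image_eqI[of _ _ "x / t"]) auto
    then show ?thesis using t by auto
  qed
  have "?f absolutely_integrable_on (*) t ` {0..} \<and> integral ((*) t ` {0..}) ?f = Gamma \<beta>"
    unfolding img using G
    by (auto intro!: nonnegative_absolutely_integrable_1 simp: integrable_on_def integral_unique)
  then have *: "(\<lambda>x. \<bar>t\<bar> * ?f (t * x)) absolutely_integrable_on {0..} \<and>
      integral {0..} (\<lambda>x. \<bar>t\<bar> * ?f (t * x)) = Gamma \<beta>"
    using t by (subst has_absolute_integral_change_of_variables_1')
      (auto intro!: derivative_eq_intros inj_onI)
  then have "((\<lambda>x. \<bar>t\<bar> * ?f (t * x)) has_integral Gamma \<beta>) {0..}"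
    using absolutely_integrable_on_def integrable_integral by metis
  then have scaled: "((\<lambda>x. 1 / t powr \<beta> * (\<bar>t\<bar> * ?f (t * x))) has_integral 1 / t powr \<beta> * Gamma \<beta>) {0..}"
    by (rule has_integral_mult_right)
  have scaled_eq: "1 / t powr \<beta> * (\<bar>t\<bar> * ?f (t * x)) = exp (- x * t) * x powr (\<beta> - 1)"
    if "x \<in> {0..}" for x
  proof -
    have "t powr \<beta> = t * t powr (\<beta> - 1)" using t powr_mult_base[of t "\<beta> - 1"] by simp
    then show ?thesis using t that
      by (simp add: powr_mult exp_minus field_simps)
  qed
  have "((\<lambda>x. exp (- x * t) * x powr (\<beta> - 1)) has_integral 1 / t powr \<beta> * Gamma \<beta>) {0..}"
    by (rule has_integral_eq[OF scaled_eq scaled])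
  then show ?thesis by simp
qed

text \<open>
  On the tail \<open>x powr (\<beta> - 1)\<close> is at most its value at \<open>M\<close>. The result is
  \<open>exp (- M * t) * (M * t) powr (\<beta> - 1)\<close> in units of \<open>1 / t powr \<beta>\<close>, and the power is at most \<open>1\<close> as
  soon as \<open>M * t\<close> is at least \<open>1\<close>.
\<close>

lemma integral_laplace_powr_tail_le:
  fixes \<beta> t M :: real
  assumes \<beta>: "0 < \<beta>" "\<beta> \<le> 1" and t: "0 < t" and M: "1 \<le> M * t"
    and T: "((\<lambda>x. exp (- x * t) * x powr (\<beta> - 1)) has_integral T) {M..}"
  shows "0 \<le> T" and "T \<le> exp (- M * t) * (1 / t powr \<beta>)"
proof -
  show "0 \<le> T" using has_integral_nonneg[OF T] by simp
  have M0: "0 < M" using M t by (smt (verit) mult_nonpos_nonneg)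
  have "((\<lambda>x. exp (- t * x) * M powr (\<beta> - 1)) has_integral (exp (- t * M) / t) * M powr (\<beta> - 1)) {M..}"
    by (intro has_integral_mult_left has_integral_exp_minus_to_infinity t)
  then have "T \<le> (exp (- t * M) / t) * M powr (\<beta> - 1)"
  proof (rule has_integral_le[OF T])
    fix x assume "x \<in> {M..}"
    then have "x powr (\<beta> - 1) \<le> M powr (\<beta> - 1)"
      using M0 \<beta> by (intro powr_mono2') auto
    then show "exp (- x * t) * x powr (\<beta> - 1) \<le> exp (- t * x) * M powr (\<beta> - 1)"
      by (simp add: mult.commute)
  qed
  also have "\<dots> = exp (- M * t) * ((M * t) powr (\<beta> - 1) * (1 / t powr \<beta>))"
  proof -
    have "t powr \<beta> = t * t powr (\<beta> - 1)" using t powr_mult_base[of t "\<beta> - 1"] by simp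
    then show ?thesis using t M0 by (simp add: powr_mult field_simps)
  qed
  also have "\<dots> \<le> exp (- M * t) * (1 * (1 / t powr \<beta>))"
  proof -
    have "(M * t) powr (\<beta> - 1) \<le> 1 powr (\<beta> - 1)"
      using M \<beta> by (intro powr_mono2') auto
    then show ?thesis by (intro mult_left_mono mult_right_mono) auto
  qed
  finally show "T \<le> exp (- M * t) * (1 / t powr \<beta>)" by simp
qed

lemma dyadic_split:
  fixes f :: "real \<Rightarrow> real"
  assumes f: "(f has_integral I) {0..}" and nonneg: "\<And>x. 0 \<le> x \<Longrightarrow> 0 \<le> f x"
  shows "I = integral {0..1} f + (\<Sum>j<N. integral {2 ^ j..2 ^ (j + 1)} f) + integral {2 ^ N..} f"
    "\<And>a b. 0 \<le> a \<Longrightarrow> f integrable_on {a..b}" "\<And>a. 0 \<le> a \<Longrightarrow> f integrable_on {a..}"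
proof -
  have abs: "f absolutely_integrable_on {0..}"
    using f nonneg by (intro nonnegative_absolutely_integrable_1) (auto simp: integrable_on_def)
  show ab: "f integrable_on {a..b}" if "0 \<le> a" for a b
    using that f by (intro integrable_on_subinterval[of f "{0..}"]) (auto simp: integrable_on_def)
  show ray: "f integrable_on {a..}" if "0 \<le> a" for a
    using set_integrable_subset[OF abs, of "{a..}"] that absolutely_integrable_on_def by auto
  have split: "integral {a..b} f + integral {b..} f = integral {a..} f" if "0 \<le> a" "a \<le> b" for a b
  proof -
    have "{a..} = {a..b} \<union> {b..}" "{a..b} \<inter> {b..} = {b}" using that by auto
    then show ?thesis
      using integral_Un[of f "{a..b}" "{b..}"] ab ray that by simp
  qed
  have "integral {1..} f = (\<Sum>j<N. integral {2 ^ j..2 ^ (j + 1)} f) + integral {2 ^ N..} f"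
  proof (induction N)
    case (Suc N)
    then show ?case using split[of "2 ^ N" "2 ^ (N + 1)"] by simp
  qed simp
  then show "I = integral {0..1} f + (\<Sum>j<N. integral {2 ^ j..2 ^ (j + 1)} f) + integral {2 ^ N..} f"
    using split[of 0 1] integral_unique[OF f] by simp
qed

lemma Gamma_lower_bound:
  obtains c :: real where "0 < c" and "\<And>x. x \<in> {1..2} \<Longrightarrow> c \<le> Gamma x"
proof -
  have "continuous_on {1..2 :: real} Gamma"
    by (intro continuous_on_Gamma continuous_on_id) (auto elim!: nonpos_Ints_cases)
  then obtain x :: real where "x \<in> {1..2}" "\<And>y. y \<in> {1..2} \<Longrightarrow> Gamma x \<le> Gamma y"
    using continuous_attains_inf[of "{1..2::real}" Gamma] by auto
  then show thesis using that[of "Gamma x"] Gamma_real_pos[of x] by auto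
qed

text \<open>
  The three summands of the bound belong to \<open>{0..1}\<close>, to the \<open>N\<close> dyadic intervals and to the tail.
  The condition \<open>t \<le> 1\<close> lets the absolute error on \<open>{0..1}\<close> be charged to \<open>1 / t powr \<beta>\<close>.
\<close>

lemma composite_gauss_error:
  assumes \<beta>: "0 < \<beta>" "\<beta> \<le> 1" and t: "0 < t" "t \<le> 1"
    and n: "0 < n\<^sub>o" and N: "1 \<le> 2 ^ N * t"
    and J: "gauss_jacobi \<beta> n\<^sub>o s\<^sub>o w\<^sub>o"
    and L: "\<And>j. j < N \<Longrightarrow> gauss_legendre (2 ^ j) (2 ^ (j + 1)) n\<^sub>l (s j) (w j)"
  shows "\<bar>Gamma \<beta> / t powr \<beta> -
      ((\<Sum>k=1..n\<^sub>o. exp (- s\<^sub>o k * t) * w\<^sub>o k) +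
       (\<Sum>j<N. \<Sum>k=1..n\<^sub>l. exp (- s j k * t) * s j k powr (\<beta> - 1) * w j k))\<bar>
    \<le> (8 / 4 ^ n\<^sub>o + real N * (4 / 4 ^ n\<^sub>l) + exp (- (2 ^ N * t))) * (1 / t powr \<beta>)"
proof -
  define f where "f x = exp (- x * t) * x powr (\<beta> - 1)" for x
  have G: "(f has_integral Gamma \<beta> / t powr \<beta>) {0..}"
    unfolding f_def using \<beta> t by (intro has_integral_laplace_powr)
  note split = dyadic_split[OF G]
  have f0: "0 \<le> f x" for x by (simp add: f_def)
  define S where "S = (\<Sum>k=1..n\<^sub>o. w\<^sub>o k * exp (- s\<^sub>o k * t))"
  define U where "U j = (\<Sum>k=1..n\<^sub>l. w j k * (exp (- s j k * t) * s j k powr (\<beta> - 1)))" for j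
  have T1: "1 \<le> 1 / t powr \<beta>"
    using t \<beta> by (simp add: powr_le1)
  have "\<bar>integral {0..1} f - S\<bar> \<le> 8 / 4 ^ n\<^sub>o * 1"
    unfolding S_def
    using gauss_jacobi_exp_error[OF J n \<beta>(1), of t] t integrable_integral[OF split(2)[OF f0, of 0 1]]
    unfolding f_def by simp
  also have "\<dots> \<le> 8 / 4 ^ n\<^sub>o * (1 / t powr \<beta>)"
    by (intro mult_left_mono T1) simp
  finally have 1: "\<bar>integral {0..1} f - S\<bar> \<le> 8 / 4 ^ n\<^sub>o * (1 / t powr \<beta>)" .
  have "\<bar>integral {2 ^ j..2 ^ (j + 1)} f - U j\<bar> \<le> 4 / 4 ^ n\<^sub>l * (1 / t powr \<beta>)" if "j < N" for j
    unfolding U_def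
    using gauss_legendre_dyadic_error[of "2 ^ j" n\<^sub>l "s j" "w j" \<beta> t] L[OF that] \<beta> t
      integrable_integral[OF split(2)[OF f0, of "2 ^ j" "2 ^ (j + 1)"]]
    unfolding f_def by simp
  then have "(\<Sum>j<N. \<bar>integral {2 ^ j..2 ^ (j + 1)} f - U j\<bar>) \<le> (\<Sum>j<N. 4 / 4 ^ n\<^sub>l * (1 / t powr \<beta>))"
    by (intro sum_mono) simp
  then have 2: "\<bar>(\<Sum>j<N. integral {2 ^ j..2 ^ (j + 1)} f) - (\<Sum>j<N. U j)\<bar>
      \<le> real N * (4 / 4 ^ n\<^sub>l) * (1 / t powr \<beta>)"
    using sum_abs[of "\<lambda>j. integral {2 ^ j..2 ^ (j + 1)} f - U j" "{..<N}"]
    by (simp add: sum_subtractf)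
  have 3: "\<bar>integral {2 ^ N..} f\<bar> \<le> exp (- (2 ^ N * t)) * (1 / t powr \<beta>)"
    using integral_laplace_powr_tail_le[OF \<beta> t(1) N] integrable_integral[OF split(3)[OF f0, of "2 ^ N"]]
    unfolding f_def by simp
  have "\<bar>Gamma \<beta> / t powr \<beta> - (S + (\<Sum>j<N. U j))\<bar>
      \<le> (8 / 4 ^ n\<^sub>o + real N * (4 / 4 ^ n\<^sub>l) + exp (- (2 ^ N * t))) * (1 / t powr \<beta>)"
    using 1 2 3 split(1)[OF f0, of N] by (simp only: distrib_right)
  then show ?thesis unfolding S_def U_def by (simp only: mult.commute)
qed

lemma abs_error_div_Gamma:
  fixes u S B :: real
  assumes \<beta>: "0 < \<beta>" and c: "0 < c" "c \<le> Gamma (1 + \<beta>)"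
    and err: "\<bar>Gamma \<beta> / u - S\<bar> \<le> B"
  shows "\<bar>1 / u - \<beta> / Gamma (1 + \<beta>) * S\<bar> \<le> \<beta> / c * B"
proof -
  have "\<beta> \<notin> \<int>\<^sub>\<le>\<^sub>0" using \<beta> nonpos_Ints_nonpos[of \<beta>] by auto
  then have G: "Gamma (1 + \<beta>) = \<beta> * Gamma \<beta>"
    using Gamma_plus1[of \<beta>] by (simp add: add.commute)
  have "Gamma \<beta> \<noteq> 0" using Gamma_real_pos[OF \<beta>] by simp
  then have "1 / u - \<beta> / Gamma (1 + \<beta>) * S = \<beta> / Gamma (1 + \<beta>) * (Gamma \<beta> / u - S)"
    unfolding G right_diff_distrib using \<beta> by simp
  then have "\<bar>1 / u - \<beta> / Gamma (1 + \<beta>) * S\<bar> = \<beta> / Gamma (1 + \<beta>) * \<bar>Gamma \<beta> / u - S\<bar>"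
    using \<beta> c by (simp only: abs_mult) simp
  also have "\<dots> \<le> \<beta> / c * B"
  proof (rule mult_mono[OF _ err])
    show "\<beta> / Gamma (1 + \<beta>) \<le> \<beta> / c"
      using c \<beta> by (intro frac_le) simp_all
    show "0 \<le> \<beta> / c" using c \<beta> by simp
  qed (rule abs_ge_zero)
  finally show ?thesis .
qed

section \<open>Choice of the parameters\<close>

lemma obtain_nat_exp_le_four_power:
  fixes x :: real
  assumes "0 \<le> x"
  obtains n :: nat where "0 < n" "real n \<le> x + 2" "exp x \<le> 4 ^ n"
proof
  let ?n = "nat \<lceil>x\<rceil> + 1"
  show "0 < ?n" by simp
  show "real ?n \<le> x + 2" using assms by linarith
  have "exp x \<le> exp (real ?n * 1)" using assms by simp linarith
  also have "\<dots> = exp 1 ^ ?n" by (rule exp_of_nat_mult)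
  also have "\<dots> \<le> 4 ^ ?n" using exp_le by (intro power_mono) auto
  finally show "exp x \<le> 4 ^ ?n" .
qed

theorem theorem3p4:
  shows "\<exists>C::real. C > 0 \<and>
    (\<forall>\<delta> \<epsilon> \<beta> :: real. 0 < \<delta> \<and> \<delta> \<le> 1 \<and> 0 < \<epsilon> \<and> 0 < \<beta> \<and> \<beta> \<le> 1 \<longrightarrow>
      (\<exists>n\<^sub>o N n\<^sub>l :: nat.
        0 < n\<^sub>o \<and> 0 < N \<and> 0 < n\<^sub>l \<and>
        real n\<^sub>o \<le> C * (1 + ln_plus (\<beta> / \<epsilon>)) \<and>
        real N \<le> C * (1 + ln (1 + ln_plus (\<beta> / \<epsilon>)) + ln (1 / \<delta>)) \<and>
        real n\<^sub>l \<le> C * (1 + ln_plus (\<beta> / \<epsilon>) + ln (1 + ln (1 / \<delta>))) \<and>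
        (\<forall>(s\<^sub>o :: nat \<Rightarrow> real) (w\<^sub>o :: nat \<Rightarrow> real)
          (s :: nat \<Rightarrow> nat \<Rightarrow> real) (w :: nat \<Rightarrow> nat \<Rightarrow> real).
          gauss_jacobi \<beta> n\<^sub>o s\<^sub>o w\<^sub>o \<and>
          (\<forall>j<N. gauss_legendre (2 ^ j) (2 ^ (j + 1)) n\<^sub>l (s j) (w j)) \<longrightarrow>
          (\<forall>t\<in>{\<delta>..1}.
            \<bar>1 / t powr \<beta> - \<beta> / Gamma (1 + \<beta>) *
              ((\<Sum>k=1..n\<^sub>o. exp (- s\<^sub>o k * t) * w\<^sub>o k) +
               (\<Sum>j<N. \<Sum>k=1..n\<^sub>l. exp (- s j k * t) * s j k powr (\<beta> - 1) * w j k))\<bar>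
            \<le> \<epsilon> * (1 / t powr \<beta>)))))"
proof -
  obtain c :: real where c: "0 < c" "\<And>x. x \<in> {1..2} \<Longrightarrow> c \<le> Gamma x"
    using Gamma_lower_bound by blast
  \<comment> \<open>The number 24 is 8 times 3: the largest numerator in the error bound and the three equal shares.
    The maximum with 1 makes the logarithm of \<open>A\<close> nonnegative.\<close>
  define A where "A = max 1 (24 / c)"
  define a where "a = ln A"
  have A: "1 \<le> A" "24 / c \<le> A" by (auto simp: A_def)
  have a: "0 \<le> a" "exp a = A" using A by (auto simp: a_def)
  define D where "D = 2 * a + 4"
  define C where "C = 3 * a + 6"
  show ?thesis
  proof (rule exI[of _ C], intro conjI allI impI, goal_cases)
    case 1
    then show ?case using a by (simp add: C_def)
  next
    case (2 \<delta> \<epsilon> \<beta>)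
    then have \<delta>: "0 < \<delta>" "\<delta> \<le> 1" and \<epsilon>: "0 < \<epsilon>" and \<beta>: "0 < \<beta>" "\<beta> \<le> 1" by auto
    define L where "L = ln_plus (\<beta> / \<epsilon>)"
    define d where "d = ln (1 / \<delta>)"
    have d: "0 \<le> d" "exp d = 1 / \<delta>" using \<delta> by (auto simp: d_def)
    have L: "0 \<le> L" by (simp add: L_def ln_plus_def)
    have "\<beta> / \<epsilon> = exp (ln (\<beta> / \<epsilon>))" using \<beta> \<epsilon> by simp
    also have "\<dots> \<le> exp L" by (simp add: L_def ln_plus_def)
    finally have eL: "\<beta> / \<epsilon> \<le> exp L" .
    obtain n\<^sub>o :: nat where no: "0 < n\<^sub>o" "real n\<^sub>o \<le> a + L + 2" "exp (a + L) \<le> 4 ^ n\<^sub>o"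
      using obtain_nat_exp_le_four_power[of "a + L"] a L by auto
    have lnaL: "0 \<le> ln (1 + a + L)" using a L by simp
    obtain m :: nat where m: "0 < m" "real m \<le> ln (1 + a + L) + d + 2"
        "exp (ln (1 + a + L) + d) \<le> 4 ^ m"
      using obtain_nat_exp_le_four_power[of "ln (1 + a + L) + d"] lnaL d by auto
    \<comment> \<open>Doubling turns the guaranteed power of 4 into the power of 2 that bounds the dyadic intervals.\<close>
    define N where "N = 2 * m"
    have N0: "0 < N" using m by (simp add: N_def)
    have "ln (1 + a + L) \<le> ln ((1 + a) * (1 + L))"
      using a L by (subst ln_le_cancel_iff) (auto simp: algebra_simps add_pos_nonneg)
    also have "\<dots> = ln (1 + a) + ln (1 + L)" using a L by (intro ln_mult_pos) auto
    also have "\<dots> \<le> a + ln (1 + L)" using a ln_add_one_self_le_self[of a] by simp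
    finally have "real N \<le> 2 * (a + ln (1 + L) + d + 2)" using m(2) by (simp add: N_def)
    also have "\<dots> \<le> D * (1 + ln (1 + L) + d)"
      using a L d by (simp add: D_def algebra_simps)
    finally have ND: "real N \<le> D * (1 + ln (1 + L) + d)" .
    have lnL: "0 \<le> ln (1 + L)" "ln (1 + L) \<le> L" using L ln_add_one_self_le_self[of L] by auto
    have D4: "4 \<le> D" using a by (simp add: D_def)
    have "ln (real N) \<le> ln (D * ((1 + L) * (1 + d)))"
    proof (subst ln_le_cancel_iff)
      have "0 \<le> L * d" using L d by simp
      then have "1 + ln (1 + L) + d \<le> (1 + L) * (1 + d)"
        using lnL by (simp add: algebra_simps)
      then have "D * (1 + ln (1 + L) + d) \<le> D * ((1 + L) * (1 + d))"
        using D4 by (intro mult_left_mono) auto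
      then show "real N \<le> D * ((1 + L) * (1 + d))" using ND by linarith
      show "0 < D * ((1 + L) * (1 + d))" using D4 L d by (intro mult_pos_pos) auto
    qed (use N0 in simp)
    also have "\<dots> = ln D + (ln (1 + L) + ln (1 + d))"
      using D4 L d by (simp add: ln_mult_pos)
    also have "\<dots> \<le> D + L + ln (1 + d)"
      using lnL ln_less_self[of D] D4 by linarith
    finally have lnN: "ln (real N) \<le> D + L + ln (1 + d)" .
    have lnN0: "0 \<le> ln (real N)" using N0 by simp
    obtain n\<^sub>l :: nat where nl: "0 < n\<^sub>l" "real n\<^sub>l \<le> a + L + ln (real N) + 2"
        "exp (a + L + ln (real N)) \<le> 4 ^ n\<^sub>l"
      using obtain_nat_exp_le_four_power[of "a + L + ln (real N)"] a L lnN0 by auto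
    have lnd: "0 \<le> ln (1 + d)" using d by simp
    have b1: "real n\<^sub>o \<le> C * (1 + L)"
    proof -
      have "real n\<^sub>o \<le> C + L" using no(2) a by (simp add: C_def)
      also have "\<dots> \<le> C + C * L" using mult_right_mono[of 1 C L] a L by (simp add: C_def)
      finally show ?thesis by (simp add: algebra_simps)
    qed
    have "D * (1 + ln (1 + L) + d) \<le> C * (1 + ln (1 + L) + d)"
      using a lnL d by (intro mult_right_mono) (auto simp: C_def D_def)
    then have b2: "real N \<le> C * (1 + ln (1 + L) + d)" using ND by linarith
    have b3: "real n\<^sub>l \<le> C * (1 + L + ln (1 + d))"
    proof -
      have "real n\<^sub>l \<le> C + 2 * L + ln (1 + d)"
        using nl(2) lnN by (simp add: C_def D_def)
      also have "\<dots> \<le> C + C * L + C * ln (1 + d)"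
        using a L lnd mult_right_mono[of 2 C L] mult_right_mono[of 1 C "ln (1 + d)"]
        by (simp add: C_def)
      finally show ?thesis by (simp add: algebra_simps)
    qed
    \<comment> \<open>The share of each of the three parts, before the prefactor of size at most \<open>\<beta> / c\<close>.\<close>
    define \<eta> where "\<eta> = c * \<epsilon> / (3 * \<beta>)"
    have \<eta>: "0 < \<eta>" using c \<epsilon> \<beta> by (simp add: \<eta>_def)
    have big: "8 / \<eta> \<le> exp (a + L)"
    proof -
      have "8 / \<eta> = 24 / c * (\<beta> / \<epsilon>)" by (simp add: \<eta>_def)
      also have "\<dots> \<le> A * exp L" using A eL c \<beta> \<epsilon> by (intro mult_mono) auto
      finally show ?thesis by (simp add: exp_add a)
    qed
    show ?case
    proof (rule exI[of _ n\<^sub>o], rule exI[of _ N], rule exI[of _ n\<^sub>l], intro conjI allI impI ballI)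
      fix s\<^sub>o w\<^sub>o :: "nat \<Rightarrow> real" and s w :: "nat \<Rightarrow> nat \<Rightarrow> real" and t :: real
      assume "gauss_jacobi \<beta> n\<^sub>o s\<^sub>o w\<^sub>o \<and>
          (\<forall>j<N. gauss_legendre (2 ^ j) (2 ^ (j + 1)) n\<^sub>l (s j) (w j))"
        and t: "t \<in> {\<delta>..1}"
      then have J: "gauss_jacobi \<beta> n\<^sub>o s\<^sub>o w\<^sub>o"
        and Leg: "\<And>j. j < N \<Longrightarrow> gauss_legendre (2 ^ j) (2 ^ (j + 1)) n\<^sub>l (s j) (w j)"
        by blast+
      show "\<bar>1 / t powr \<beta> - \<beta> / Gamma (1 + \<beta>) *
              ((\<Sum>k=1..n\<^sub>o. exp (- s\<^sub>o k * t) * w\<^sub>o k) +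
               (\<Sum>j<N. \<Sum>k=1..n\<^sub>l. exp (- s j k * t) * s j k powr (\<beta> - 1) * w j k))\<bar>
            \<le> \<epsilon> * (1 / t powr \<beta>)"
      proof -
        let ?S = "(\<Sum>k=1..n\<^sub>o. exp (- s\<^sub>o k * t) * w\<^sub>o k) +
                 (\<Sum>j<N. \<Sum>k=1..n\<^sub>l. exp (- s j k * t) * s j k powr (\<beta> - 1) * w j k)"
        have t': "0 < t" "t \<le> 1" "\<delta> \<le> t" using t \<delta> by auto
        have "(1 + a + L) / \<delta> \<le> 2 ^ N"
          using m(3) a L d by (simp add: exp_add N_def power_mult)
        then have "1 + a + L \<le> 2 ^ N * \<delta>" using \<delta> by (simp add: field_simps)
        also have "\<dots> \<le> 2 ^ N * t" using t' by (intro mult_left_mono) auto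
        finally have X: "1 + a + L \<le> 2 ^ N * t" .
        have e1: "8 / 4 ^ n\<^sub>o \<le> \<eta>"
        proof -
          have "8 / \<eta> \<le> 4 ^ n\<^sub>o" using big no(3) \<eta> by (smt (verit) divide_right_mono)
          then show ?thesis using \<eta> by (simp add: field_simps)
        qed
        have e2: "real N * (4 / 4 ^ n\<^sub>l) \<le> \<eta>"
        proof -
          have "8 / \<eta> * real N \<le> exp (a + L) * real N" using big by (intro mult_right_mono) auto
          also have "\<dots> = exp (a + L + ln (real N))" using N0 by (simp add: exp_add)
          also have "\<dots> \<le> 4 ^ n\<^sub>l" by (rule nl(3))
          finally show ?thesis using \<eta> by (simp add: field_simps)
        qed
        have e3: "exp (- (2 ^ N * t)) \<le> \<eta>"
        proof -
          have "exp (a + L) \<le> exp (2 ^ N * t)" using X by simp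
          then have "1 / \<eta> \<le> exp (2 ^ N * t)" using big \<eta> by (smt (verit) divide_right_mono)
          then show ?thesis using \<eta> by (simp add: exp_minus field_simps)
        qed
        have "1 \<le> 2 ^ N * t" using X a L by linarith
        note composite_gauss_error[OF \<beta> t'(1,2) no(1) this J Leg]
        also have "(8 / 4 ^ n\<^sub>o + real N * (4 / 4 ^ n\<^sub>l) + exp (- (2 ^ N * t))) * (1 / t powr \<beta>)
            \<le> (3 * \<eta>) * (1 / t powr \<beta>)"
          using e1 e2 e3 by (intro mult_right_mono) auto
        finally have err: "\<bar>Gamma \<beta> / t powr \<beta> - ?S\<bar> \<le> (3 * \<eta>) * (1 / t powr \<beta>)" by simp
        have "c \<le> Gamma (1 + \<beta>)" using c(2) \<beta> by simp
        then have "\<bar>1 / t powr \<beta> - \<beta> / Gamma (1 + \<beta>) * ?S\<bar> \<le> \<beta> / c * ((3 * \<eta>) * (1 / t powr \<beta>))"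
          by (rule abs_error_div_Gamma[OF \<beta>(1) c(1) _ err])
        also have "\<beta> / c * ((3 * \<eta>) * (1 / t powr \<beta>)) = \<epsilon> * (1 / t powr \<beta>)"
          using c \<beta> by (simp add: \<eta>_def)
        finally show ?thesis .
      qed
    qed (fact no(1) N0 nl(1) b1[unfolded L_def] b2[unfolded L_def d_def] b3[unfolded L_def d_def])+
  qed
qed

end
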